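(* Given any order $\mathbf{S}=(H_l,S_1,\dots,S_J,H_r)$ with any spacings $\mathbf{D}_{\mathbf{S}}$, $I(p)$ attains local maximums on $\overline{H_lH_r}$ at the end nodes $H_l$ and $H_r$, and at the midpoints of all pairs of neighbor nodes in $(S_1,\dots,S_J)$. In particular, $$\arg\max_{p\in\overline{H_lS_1}}I(p)=H_l,\qquad \arg\max_{p\in\overline{S_JH_r}}I(p)=H_r,$$ $$\arg\max_{p\in\overline{S_iS_{i+1}}}I(p)=Y_{S_iS_{i+1}}\quad\text{for all } i\in\{1,\dots,J-1\}.$$
   Context: All points lie on a line. There are $M$ transmitters and $N$ receivers (the transmitters being indexed by $\{1,\dots,M\}$ and the receivers by $\{1,\dots,N\}$), $J=M+N$, and two virtual end nodes $H_l$ (leftmost) and $H_r$ (rightmost). A (deployment) order is a sequence $\mathbf{S}=(H_l,S_1,\dots,S_J,H_r)$ where $(S_1,\dots,S_J)$ is a permutation of the set of all transmitters and receivers, listed from left to right: $0\le\|H_lS_1\|\le\cdots\le\|H_lS_J\|\le\|H_lH_r\|$, where $\|ab\|$ is the distance between points $a$ and $b$. Its spacings are the distances between neighbors, $\mathbf{D}_{\mathbf{S}}=(\|H_lS_1\|,\|S_1S_2\|,\dots,\|S_{J-1}S_J\|,\|S_JH_r\|)$; order plus spacings determine all locations. For a point $p$, $I(p)$ is the minimum of $\|T_ip\|\,\|R_jp\|$ over all transmitters $T_i$ and receivers $R_j$. $\overline{ab}$ denotes the line segment between points $a$ and $b$, and $Y_{ab}$ denotes the midpoint of $a$ and $b$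.
   Formalization: Each local-maximum claim on H_lH_r is stated only when the spacing concerned (|H_lS_1|, |S_JH_r| or |S_iS_{i+1}|) is positive; with zero spacing it fails, e.g. T and R both at 0, H_l=-1, H_r=1 gives I(p)=p^2. The argmax claims are unconditional. *)

theory Defs
  imports "HOL-Analysis.Analysis"
begin

datatype node = EndL | EndR | Tx nat | Rx nat

definition deployment_order :: "nat \<Rightarrow> nat \<Rightarrow> node list \<Rightarrow> bool" where
  "deployment_order M N S \<longleftrightarrow>
     (\<exists>Ss. S = EndL # Ss @ [EndR] \<and> distinct Ss \<and> set Ss = Tx ` {1..M} \<union> Rx ` {1..N})"

text \<open>
  The line is \<^typ>\<open>real\<close>, oriented from left to right, and \<open>x v\<close> is the location of node \<open>v\<close>;
  the location of the left end is an arbitrary real.  Distinct nodes may be located at the same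
  point, that is, spacings may be zero.
\<close>

definition left_to_right :: "node list \<Rightarrow> (node \<Rightarrow> real) \<Rightarrow> bool" where
  "left_to_right S x \<longleftrightarrow> sorted (map x S)"

definition spacings :: "node list \<Rightarrow> (node \<Rightarrow> real) \<Rightarrow> real list" where
  "spacings S x = map (\<lambda>k. dist (x (S ! k)) (x (S ! Suc k))) [0..<length S - 1]"

text \<open>The minimum is meaningful only if there is at least one transmitter and one receiver.\<close>

definition intensity :: "nat \<Rightarrow> nat \<Rightarrow> (node \<Rightarrow> real) \<Rightarrow> real \<Rightarrow> real" where
  "intensity M N x p =
     Min ((\<lambda>(i, j). dist (x (Tx i)) p * dist (x (Rx j)) p) ` ({1..M} \<times> {1..N}))"

text \<open>The set of all maximizers, so \<open>argmax_on f A = {a}\<close> says that \<open>a\<close> is the unique one.\<close>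

definition argmax_on :: "('a \<Rightarrow> real) \<Rightarrow> 'a set \<Rightarrow> 'a set" where
  "argmax_on f A = {p. is_arg_max f (\<lambda>q. q \<in> A) p}"

definition local_max_on :: "('a::topological_space \<Rightarrow> real) \<Rightarrow> 'a set \<Rightarrow> 'a \<Rightarrow> bool" where
  "local_max_on f A p \<longleftrightarrow> p \<in> A \<and> (\<forall>\<^sub>F q in at p within A. f q \<le> f p)"

end

theory Submission
  imports Defs
begin

text \<open>
  Let \<open>a \<le> b\<close> be locations of neighboring nodes, \<open>m\<close> their midpoint, and \<open>a \<le> p < m\<close>. If the node at
  \<open>a\<close> is, say, a transmitter, then it is a nearest transmitter to \<open>m\<close>, so some receiver at \<open>v\<close> has
  \<open>I(m) = \<bar>a - m\<bar> \<bar>v - m\<bar>\<close>. As \<open>v\<close> lies outside \<open>(a, b)\<close>, the product \<open>\<bar>a - p\<bar> \<bar>v - p\<bar> \<ge> I(p)\<close> is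
  strictly smaller. The case \<open>p > m\<close> is the mirror image. At an end node all distances decrease as
  \<open>p\<close> moves inwards.
\<close>

lemma argmax_on_eq_singletonI:
  assumes "c \<in> A" and "\<And>q. q \<in> A \<Longrightarrow> q \<noteq> c \<Longrightarrow> f q < f c"
  shows "argmax_on f A = {c}"
  using assms unfolding argmax_on_def is_arg_max_def
  by (auto dest: less_asym)

lemma local_max_onI:
  assumes "p \<in> A" and "open U" and "p \<in> U" and "\<And>q. q \<in> A \<inter> U \<Longrightarrow> q \<noteq> p \<Longrightarrow> f q \<le> f p"
  shows "local_max_on f A p"
  using assms unfolding local_max_on_def eventually_at_topological
  by (auto intro!: exI[of _ U])

text \<open>If \<open>v\<close> is left of \<open>a\<close>, both factors grow as \<open>p\<close>
  moves right. If \<open>v\<close> is right of \<open>b\<close>, then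
  \<open>(p - a) * (v - p)\<close> is a downward parabola in \<open>p\<close> whose vertex
  \<open>(a + v) / 2\<close> is not left of the midpoint, so it still increases up to there.\<close>

lemma dist_mult_less_left:
  fixes a b p v :: real
  assumes "a \<le> p" and "p < midpoint a b" and "v \<le> a \<or> b \<le> v"
  shows "dist a p * dist v p < dist a (midpoint a b) * dist v (midpoint a b)"
  using assms(3)
proof
  define m where "m = midpoint a b"
  have m: "2 * m = a + b" by (simp add: m_def midpoint_def)
  have p: "a \<le> p" "p < m" using assms by (simp_all add: m_def)
  {
    assume "v \<le> a"
    then have "(p - a) * (p - v) < (m - a) * (m - v)"
      using p by (intro mult_strict_mono) auto
    then show "dist a p * dist v p < dist a (midpoint a b) * dist v (midpoint a b)"
      using p \<open>v \<le> a\<close> by (simp add: m_def[symmetric] dist_real_def)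
  next
    assume "b \<le> v"
    \<comment> \<open>This is the factored difference of the two products compared next. The second
      factor is positive because \<open>v + a\<close> is at least \<open>a + b = 2 * m\<close>,
      which exceeds \<open>m + p\<close>.\<close>
    then have "0 < (m - p) * (v + a - m - p)"
      using p m by (intro mult_pos_pos) auto
    then have "(p - a) * (v - p) < (m - a) * (v - m)"
      by (simp add: algebra_simps)
    then show "dist a p * dist v p < dist a (midpoint a b) * dist v (midpoint a b)"
      using p m \<open>b \<le> v\<close> by (simp add: m_def[symmetric] dist_real_def)
  }
qed

lemma dist_mult_less_right:
  fixes a b p v :: real
  assumes "p \<le> b" and "midpoint a b < p" and "v \<le> a \<or> b \<le> v"
  shows "dist b p * dist v p < dist b (midpoint a b) * dist v (midpoint a b)"
proof -
  \<comment> \<open>Reflection in the origin keeps distances and exchanges the roles of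
    \<open>a\<close> and \<open>b\<close>.\<close>
  have "midpoint (- b) (- a) = - midpoint a b"
    by (simp add: midpoint_def algebra_simps)
  then show ?thesis
    using dist_mult_less_left[of "- b" "- p" "- a" "- v"] assms by (auto simp: dist_minus)
qed

abbreviation devices :: "nat \<Rightarrow> nat \<Rightarrow> node set" where
  "devices M N \<equiv> Tx ` {1..M} \<union> Rx ` {1..N}"

text \<open>The minimum at \<open>q\<close> is attained by some pair, so it suffices to beat each
  pair at \<open>q\<close> by some pair at \<open>p\<close>. The two pairs may differ, which allows
  one member to be exchanged for a nearer device.\<close>

lemma intensity_less:
  assumes "M \<ge> 1" and "N \<ge> 1"
    and "\<And>i j. i \<in> {1..M} \<Longrightarrow> j \<in> {1..N} \<Longrightarrow> \<exists>i'\<in>{1..M}. \<exists>j'\<in>{1..N}.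
      dist (x (Tx i')) p * dist (x (Rx j')) p < dist (x (Tx i)) q * dist (x (Rx j)) q"
  shows "intensity M N x p < intensity M N x q"
proof -
  let ?F = "\<lambda>r (i, j). dist (x (Tx i)) r * dist (x (Rx j)) r"
  let ?K = "{1..M} \<times> {1..N}"
  have "intensity M N x q \<in> ?F q ` ?K"
    unfolding intensity_def using assms(1,2) by (intro Min_in) auto
  then obtain k l where "k \<in> {1..M}" "l \<in> {1..N}" and q: "intensity M N x q = ?F q (k, l)"
    by auto
  with assms(3) obtain i j where ij: "(i, j) \<in> ?K" and less: "?F p (i, j) < ?F q (k, l)"
    by force
  have "intensity M N x p \<le> ?F p (i, j)"
    unfolding intensity_def using ij by (intro Min_le imageI) auto
  also note less
  finally show ?thesis using q by simp
qed

text \<open>In any pair, the member of the same kind as \<open>w\<close> can be replaced by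
  \<open>w\<close>: by \<open>near\<close> this does not increase the product at \<open>q\<close>,
  and by \<open>less\<close> passing from \<open>q\<close> to \<open>p\<close> then decreases it
  strictly.\<close>

lemma intensity_less_of_device:
  assumes "M \<ge> 1" and "N \<ge> 1" and w: "w \<in> devices M N"
    and near: "\<And>v. v \<in> devices M N \<Longrightarrow> dist (x w) q \<le> dist (x v) q"
    and less: "\<And>v. v \<in> devices M N \<Longrightarrow>
      dist (x w) p * dist (x v) p < dist (x w) q * dist (x v) q"
  shows "intensity M N x p < intensity M N x q"
proof (rule intensity_less[OF assms(1,2)])
  fix i j assume i: "i \<in> {1..M}" and j: "j \<in> {1..N}"
  from w consider k where "k \<in> {1..M}" "w = Tx k" | k where "k \<in> {1..N}" "w = Rx k" by blast
  then show "\<exists>i'\<in>{1..M}. \<exists>j'\<in>{1..N}.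
    dist (x (Tx i')) p * dist (x (Rx j')) p < dist (x (Tx i)) q * dist (x (Rx j)) q"
  proof cases
    case 1
    have "dist (x (Tx k)) p * dist (x (Rx j)) p < dist (x (Tx k)) q * dist (x (Rx j)) q"
      using less[of "Rx j"] 1 j by simp
    also have "\<dots> \<le> dist (x (Tx i)) q * dist (x (Rx j)) q"
      using near[of "Tx i"] 1 i by (intro mult_right_mono) auto
    finally show ?thesis using 1 j by blast
  next
    case 2
    have "dist (x (Tx i)) p * dist (x (Rx k)) p < dist (x (Tx i)) q * dist (x (Rx k)) q"
      using less[of "Tx i"] 2 i by (simp add: mult.commute)
    also have "\<dots> \<le> dist (x (Tx i)) q * dist (x (Rx j)) q"
      using near[of "Rx j"] 2 j by (intro mult_left_mono) auto
    finally show ?thesis using 2 i by blast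
  qed
qed

text \<open>Both \<open>s\<close> and \<open>t\<close> are nearest devices to the midpoint, whatever
  their kinds. The half of the segment that contains \<open>p\<close> decides which of them is used
  as \<open>w\<close>.\<close>

lemma intensity_less_midpoint:
  assumes MN: "M \<ge> 1" "N \<ge> 1" and dev: "s \<in> devices M N" "t \<in> devices M N"
    and gap: "\<And>v. v \<in> devices M N \<Longrightarrow> x v \<le> x s \<or> x t \<le> x v"
    and p: "x s \<le> p" "p \<le> x t" "p \<noteq> midpoint (x s) (x t)"
  shows "intensity M N x p < intensity M N x (midpoint (x s) (x t))"
proof -
  define m where "m = midpoint (x s) (x t)"
  have m: "2 * m = x s + x t" by (simp add: m_def midpoint_def)
  have near: "dist (x s) m \<le> dist (x v) m" "dist (x t) m \<le> dist (x v) m"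
    if "v \<in> devices M N" for v
    using gap[OF that] m p by (auto simp: dist_real_def)
  show ?thesis
  proof (cases "p < m")
    case True
    then show ?thesis
      using intensity_less_of_device[OF MN dev(1), of x m p] near(1)
        dist_mult_less_left[of "x s" p "x t"] gap p by (auto simp: m_def)
  next
    case False
    then have "m < p" using p by (simp add: m_def)
    then show ?thesis
      using intensity_less_of_device[OF MN dev(2), of x m p] near(2)
        dist_mult_less_right[of p "x t" "x s"] gap p by (auto simp: m_def)
  qed
qed

text \<open>Both factors of every product shrink strictly, so each pair is beaten by itself; a
  factor may even vanish at \<open>p\<close>.\<close>

lemma intensity_less_end:
  assumes "M \<ge> 1" and "N \<ge> 1"
    and "\<And>v. v \<in> devices M N \<Longrightarrow> dist (x v) p < dist (x v) q"
  shows "intensity M N x p < intensity M N x q"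
proof (rule intensity_less[OF assms(1,2)])
  fix i j assume ij: "i \<in> {1..M}" "j \<in> {1..N}"
  then have "dist (x (Tx i)) p * dist (x (Rx j)) p < dist (x (Tx i)) q * dist (x (Rx j)) q"
    using assms(3)[of "Tx i"] assms(3)[of "Rx j"]
    by (intro mult_strict_mono') auto
  with ij show "\<exists>i'\<in>{1..M}. \<exists>j'\<in>{1..N}.
      dist (x (Tx i')) p * dist (x (Rx j')) p < dist (x (Tx i)) q * dist (x (Rx j)) q"
    by blast
qed

theorem lemma1:
  fixes M N :: nat and S :: "node list" and D :: "real list" and x :: "node \<Rightarrow> real"
  assumes "M \<ge> 1" and "N \<ge> 1"
    and "deployment_order M N S"
    and "left_to_right S x"
    and "D = spacings S x"
  shows
    "(D ! 0 > 0 \<longrightarrow>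
        local_max_on (intensity M N x) (closed_segment (x EndL) (x EndR)) (x EndL)) \<and>
     (D ! (M + N) > 0 \<longrightarrow>
        local_max_on (intensity M N x) (closed_segment (x EndL) (x EndR)) (x EndR)) \<and>
     (\<forall>i\<in>{1..M + N - 1}. D ! i > 0 \<longrightarrow>
        local_max_on (intensity M N x) (closed_segment (x EndL) (x EndR))
          (midpoint (x (S ! i)) (x (S ! (i + 1))))) \<and>
     argmax_on (intensity M N x) (closed_segment (x EndL) (x (S ! 1))) = {x EndL} \<and>
     argmax_on (intensity M N x) (closed_segment (x (S ! (M + N))) (x EndR)) = {x EndR} \<and>
     (\<forall>i\<in>{1..M + N - 1}.
        argmax_on (intensity M N x) (closed_segment (x (S ! i)) (x (S ! (i + 1))))
          = {midpoint (x (S ! i)) (x (S ! (i + 1)))})"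
proof -
  obtain Ss where S: "S = EndL # Ss @ [EndR]" and Ss: "distinct Ss" "set Ss = devices M N"
    using assms(3) unfolding deployment_order_def by blast
  have "card (devices M N) = M + N"
    by (subst card_Un_disjoint) (auto simp: card_image inj_on_def)
  then have len: "length Ss = M + N"
    using Ss distinct_card by metis
  \<comment> \<open>As \<open>EndL\<close> occupies position 0, the devices occupy exactly the
    positions 1 to \<open>M + N\<close>.\<close>
  have first: "S ! 0 = EndL" and last: "S ! Suc (M + N) = EndR"
    using len by (simp_all add: S nth_append)
  have mono: "x (S ! i) \<le> x (S ! j)" if "i \<le> j" "j \<le> Suc (M + N)" for i j
    using assms(4) that len sorted_nth_mono[of "map x S" i j]
    by (simp add: left_to_right_def S del: sorted_map map_append list.map)
  have dev: "S ! i \<in> devices M N" if "1 \<le> i" "i \<le> M + N" for i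
  proof -
    have "S ! i = Ss ! (i - 1)" using that len by (cases i) (simp_all add: S nth_append)
    then show ?thesis using that len Ss(2) nth_mem[of "i - 1" Ss] by simp
  qed
  have index: "\<exists>k. 1 \<le> k \<and> k \<le> M + N \<and> S ! k = v" if "v \<in> devices M N" for v
  proof -
    obtain k where "k < length Ss" "Ss ! k = v"
      using \<open>v \<in> devices M N\<close> Ss(2) by (metis in_set_conv_nth)
    then have "S ! Suc k = v" "Suc k \<le> M + N" using len by (simp_all add: S nth_append)
    then show ?thesis by (intro exI[of _ "Suc k"]) simp
  qed
  have D: "D ! i = x (S ! Suc i) - x (S ! i)" if "i \<le> M + N" for i
  proof -
    have "i < length S - 1" using that len by (simp add: S)
    then show ?thesis
      using that mono[of i "Suc i"] by (simp add: assms(5) spacings_def dist_real_def)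
  qed

  let ?I = "intensity M N x"
  let ?A = "closed_segment (x EndL) (x EndR)"
  have A: "?A = {x EndL..x EndR}" and EA: "x EndL \<le> x EndR"
    using mono[of 0 "Suc (M + N)"] first last by (simp_all add: closed_segment_eq_real_ivl)

  have left: "?I p < ?I (x EndL)" if "x EndL < p" "p \<le> x (S ! 1)" for p
  proof (rule intensity_less_end[OF assms(1,2)])
    fix v assume "v \<in> devices M N"
    then obtain k where "1 \<le> k" "k \<le> M + N" "S ! k = v" using index by blast
    then have "x (S ! 1) \<le> x v" using mono[of 1 k] by simp
    then show "dist (x v) p < dist (x v) (x EndL)" using that by (simp add: dist_real_def)
  qed
  have right: "?I p < ?I (x EndR)" if "x (S ! (M + N)) \<le> p" "p < x EndR" for p
  proof (rule intensity_less_end[OF assms(1,2)])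
    fix v assume "v \<in> devices M N"
    then obtain k where "1 \<le> k" "k \<le> M + N" "S ! k = v" using index by blast
    then have "x v \<le> x (S ! (M + N))" using mono[of k "M + N"] by simp
    then show "dist (x v) p < dist (x v) (x EndR)" using that by (simp add: dist_real_def)
  qed
  have mid: "?I p < ?I (midpoint (x (S ! i)) (x (S ! (i + 1))))"
    if "i \<in> {1..M + N - 1}" "x (S ! i) \<le> p" "p \<le> x (S ! (i + 1))"
      "p \<noteq> midpoint (x (S ! i)) (x (S ! (i + 1)))" for i p
  \<comment> \<open>The open goal is the gap condition: a device has position at most
    \<open>i\<close> or at least \<open>i + 1\<close>, and locations are monotone in the
    position.\<close>
  proof (rule intensity_less_midpoint[OF assms(1,2) dev dev _ that(2-4)])
    fix v assume "v \<in> devices M N"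
    then obtain k where k: "1 \<le> k" "k \<le> M + N" "S ! k = v" using index by blast
    show "x v \<le> x (S ! i) \<or> x (S ! (i + 1)) \<le> x v"
    proof (cases "k \<le> i")
      case True
      then show ?thesis using mono[of k i] k that(1) by auto
    next
      case False
      then show ?thesis using mono[of "i + 1" k] k by auto
    qed
  qed (use that(1) in auto)

  have left_end: "x EndL \<le> x (S ! 1)" and right_end: "x (S ! (M + N)) \<le> x EndR"
    using mono[of 0 1] mono[of "M + N" "Suc (M + N)"] first last by simp_all

  \<comment> \<open>A positive spacing makes \<open>U\<close> a neighborhood of the candidate that
    meets \<open>?A\<close> only where the strict comparison applies. With zero spacing a device
    would sit on the candidate, and \<open>?I\<close> would take its least possible value 0
    there.\<close>
  have "local_max_on ?I ?A (x EndL)" if "D ! 0 > 0"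
  proof (rule local_max_onI[where U = "{..<x (S ! 1)}"])
    show "x EndL \<in> {..<x (S ! 1)}" using that D[of 0] first by simp
  qed (use left in \<open>auto simp: A EA intro!: less_imp_le\<close>)
  moreover have "local_max_on ?I ?A (x EndR)" if "D ! (M + N) > 0"
  proof (rule local_max_onI[where U = "{x (S ! (M + N))<..}"])
    show "x EndR \<in> {x (S ! (M + N))<..}" using that D[of "M + N"] last by simp
  qed (use right in \<open>auto simp: A EA intro!: less_imp_le\<close>)
  moreover have "local_max_on ?I ?A (midpoint (x (S ! i)) (x (S ! (i + 1))))"
    if i: "i \<in> {1..M + N - 1}" and "D ! i > 0" for i
  proof (rule local_max_onI[where U = "{x (S ! i)<..<x (S ! (i + 1))}"])
    have less: "x (S ! i) < x (S ! (i + 1))" using that D[of i] by auto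
    then show U: "midpoint (x (S ! i)) (x (S ! (i + 1))) \<in> {x (S ! i)<..<x (S ! (i + 1))}"
      by (simp add: midpoint_def field_simps)
    have "x EndL \<le> x (S ! i)" "x (S ! (i + 1)) \<le> x EndR"
      using mono[of 0 i] mono[of "i + 1" "Suc (M + N)"] first last i by auto
    with U show "midpoint (x (S ! i)) (x (S ! (i + 1))) \<in> ?A" unfolding A by auto
  qed (use mid[OF i] in \<open>auto intro!: less_imp_le\<close>)
  \<comment> \<open>For the three argmax claims a zero spacing is harmless: the segment is then a
    single point without competitors.\<close>
  moreover have "argmax_on ?I (closed_segment (x EndL) (x (S ! 1))) = {x EndL}"
    using left left_end by (intro argmax_on_eq_singletonI) (auto simp: closed_segment_eq_real_ivl)
  moreover have "argmax_on ?I (closed_segment (x (S ! (M + N))) (x EndR)) = {x EndR}"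
    using right right_end by (intro argmax_on_eq_singletonI) (auto simp: closed_segment_eq_real_ivl)
  moreover have "argmax_on ?I (closed_segment (x (S ! i)) (x (S ! (i + 1))))
      = {midpoint (x (S ! i)) (x (S ! (i + 1)))}" if i: "i \<in> {1..M + N - 1}" for i
  proof (rule argmax_on_eq_singletonI)
    have "x (S ! i) \<le> x (S ! (i + 1))" using mono[of i "i + 1"] i by auto
    then show "?I q < ?I (midpoint (x (S ! i)) (x (S ! (i + 1))))"
      if "q \<in> closed_segment (x (S ! i)) (x (S ! (i + 1)))"
        "q \<noteq> midpoint (x (S ! i)) (x (S ! (i + 1)))" for q
      using mid[OF i] that by (simp add: closed_segment_eq_real_ivl)
  qed simp
  ultimately show ?thesis by (intro conjI ballI impI)
qed

end
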